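(* Let $X$ and $Y$ be graphs on $n$ vertices, and let $X_1,\ldots,X_r$ be the connected components of $X$. For $i\in[r]$, let $n_i=|V(X_i)|$. Let $\mathcal{OP}_{n_1,\ldots,n_r}(Y)$ denote the collection of ordered set partitions $(V_1,\ldots,V_r)$ of $V(Y)$ such that $|V_i|=n_i$ for all $i\in[r]$. Then \[\mathsf{FS}(X,Y)\cong\bigoplus_{(V_1,\ldots,V_r)\in\mathcal{OP}_{n_1,\ldots,n_r}(Y)}\left(\mathsf{FS}(X_1,Y\vert_{V_1})\,\square\cdots\square\,\mathsf{FS}(X_r,Y\vert_{V_r})\right).\]
   Context: All graphs are finite and simple; $[r]=\{1,\ldots,r\}$. For graphs $X,Y$ with $|V(X)|=|V(Y)|$, the friends-and-strangers graph $\mathsf{FS}(X,Y)$ has as vertices all bijections $\sigma\colon V(X)\to V(Y)$; two bijections $\sigma,\sigma'$ are adjacent iff there is an edge $\{a,b\}\in E(X)$ with $\{\sigma(a),\sigma(b)\}\in E(Y)$, $\sigma(a)=\sigma'(b)$, $\sigma(b)=\sigma'(a)$, and $\sigma(c)=\sigma'(c)$ for all $c\in V(X)\setminus\{a,b\}$. $Y\vert_{V_0}$ is the induced subgraph of $Y$ on the vertex set $V_0$. $\bigoplus$ denotes disjoint union of graphs. The Cartesian product $G_1\square\cdots\square\,G_r$ has vertex set $V(G_1)\times\cdots\times V(G_r)$, with $(a_1,\ldots,a_r)$ and $(b_1,\ldots,b_r)$ adjacent iff there is an index $i$ with $\{a_i,b_i\}\in E(G_i)$ and $a_j=b_j$ for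 all $j\neq i$. *)

theory Defs
  imports
    "HOL-Library.FuncSet"
    "HOL-Library.Disjoint_Sets"
    "Graph_Theory.Digraph_Component"
    "Graph_Theory.Digraph_Isomorphism"
begin

text \<open>
  A finite simple graph is a digraph satisfying \<^locale>\<open>graph\<close>: finite, loopfree, without
  parallel arcs, and symmetric, so that an undirected edge between \<open>a\<close> and \<open>b\<close> is the pair of
  arcs \<open>a \<rightarrow> b\<close> and \<open>b \<rightarrow> a\<close>. Graphs constructed below are given as
  \<^type>\<open>pair_pre_digraph\<close> records (a vertex set and a symmetric relation), which
  \<^const>\<open>with_proj\<close> coerces to digraphs.
\<close>

definition components :: "('a, 'b) pre_digraph \<Rightarrow> ('a, 'b) pre_digraph set" where
  "components G = {H. pre_digraph.max_subgraph G Digraph_Component.connected H}"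

text \<open>
  Bijections are taken in \<^const>\<open>extensional\<close>, so that each bijection between the vertex sets is
  represented by exactly one function.
\<close>

definition vertex_bijections ::
    "('a, 'b) pre_digraph \<Rightarrow> ('c, 'd) pre_digraph \<Rightarrow> ('a \<Rightarrow> 'c) set" where
  "vertex_bijections X Y = {\<sigma> \<in> extensional (verts X). bij_betw \<sigma> (verts X) (verts Y)}"

definition FS ::
    "('a, 'b) pre_digraph \<Rightarrow> ('c, 'd) pre_digraph \<Rightarrow> ('a \<Rightarrow> 'c) pair_pre_digraph" where
  "FS X Y =
    \<lparr> pverts = vertex_bijections X Y,
      parcs = {(\<sigma>, \<sigma>'). \<sigma> \<in> vertex_bijections X Y \<and> \<sigma>' \<in> vertex_bijections X Y \<and>
        (\<exists>a b. a \<rightarrow>\<^bsub>X\<^esub> b \<and> \<sigma> a \<rightarrow>\<^bsub>Y\<^esub> \<sigma> b \<and> \<sigma> a = \<sigma>' b \<and> \<sigma> b = \<sigma>' a \<and>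
          (\<forall>c \<in> verts X - {a, b}. \<sigma> c = \<sigma>' c))} \<rparr>"

definition cartesian_product ::
    "'i set \<Rightarrow> ('i \<Rightarrow> 'a pair_pre_digraph) \<Rightarrow> ('i \<Rightarrow> 'a) pair_pre_digraph" where
  "cartesian_product I G =
    \<lparr> pverts = (\<Pi>\<^sub>E i\<in>I. pverts (G i)),
      parcs = {(u, v). u \<in> (\<Pi>\<^sub>E i\<in>I. pverts (G i)) \<and> v \<in> (\<Pi>\<^sub>E i\<in>I. pverts (G i)) \<and>
        (\<exists>i\<in>I. (u i, v i) \<in> parcs (G i) \<and> (\<forall>j\<in>I - {i}. u j = v j))} \<rparr>"

definition disjoint_union ::
    "'i set \<Rightarrow> ('i \<Rightarrow> 'a pair_pre_digraph) \<Rightarrow> ('i \<times> 'a) pair_pre_digraph" where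
  "disjoint_union I G =
    \<lparr> pverts = (SIGMA i:I. pverts (G i)),
      parcs = {((i, u), (j, v)) | i u j v. i \<in> I \<and> i = j \<and> (u, v) \<in> parcs (G i)} \<rparr>"

text \<open>
  \<open>ordered_partitions r m A\<close> is the set of ordered set partitions \<open>(V 1, \<dots>, V r)\<close> of \<open>A\<close> whose
  \<open>i\<close>-th part has \<open>m i\<close> elements. Injectivity of \<open>V\<close> makes parts at different positions distinct,
  hence disjoint.
\<close>

definition ordered_partitions ::
    "nat \<Rightarrow> (nat \<Rightarrow> nat) \<Rightarrow> 'a set \<Rightarrow> (nat \<Rightarrow> 'a set) set" where
  "ordered_partitions r m A =
    {V \<in> extensional {1..r}. inj_on V {1..r} \<and> partition_on A (V ` {1..r}) \<and>
      (\<forall>i\<in>{1..r}. card (V i) = m i)}"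

end

theory Submission
  imports Defs
begin

text \<open>
  A swap of \<open>FS X Y\<close> takes place along an edge of \<open>X\<close>, and every edge of \<open>X\<close> lies inside a single
  component \<open>X\<^sub>i\<close>. So a swap permutes the labels sitting on \<open>X\<^sub>i\<close> among themselves and changes
  nothing on the other components. Consequently the tuple of label sets \<open>V\<^sub>i = \<sigma>(V(X\<^sub>i))\<close> is
  invariant under swaps, and it splits \<open>FS X Y\<close> into pieces without edges between them, one for
  each ordered partition \<open>(V\<^sub>1, \<dots>, V\<^sub>r)\<close> of \<open>V(Y)\<close> into sets of the right sizes. Inside one piece, a
  bijection is the same thing as a tuple of bijections \<open>\<sigma>\<^sub>i : V(X\<^sub>i) \<rightarrow> V\<^sub>i\<close>, and a swap is a swap in
  exactly one coordinate \<open>FS X\<^sub>i (Y|V\<^sub>i)\<close>: this is adjacency in the Cartesian product.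

  The isomorphism is therefore \<open>\<sigma> \<mapsto> ((\<sigma>(V(X\<^sub>i)))\<^sub>i, (\<sigma>|V(X\<^sub>i))\<^sub>i)\<close>. It is bijective by
  \<open>bij_betw_split\<close>, where surjectivity is the gluing of a tuple of bijections, and it preserves and
  reflects adjacency by \<open>FS_adj_iff\<close>. Both facts use only that the pieces \<open>X\<^sub>i\<close> are nonempty and
  disjoint, cover the vertices of \<open>X\<close> and contain between them exactly its edges; the locale
  \<open>graph_splitting\<close> isolates these properties. That connected components have them follows from
  the corresponding facts on strongly connected components, since in a symmetric digraph both
  kinds of component coincide (\<open>components_eq_sccs\<close>).
\<close>

section \<open>Connected components of symmetric digraphs\<close>

lemma (in wf_digraph) strongly_connected_imp_connected:
  assumes "strongly_connected G"
  shows "connected G"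
  using assms reachable_mk_symmetricI
  by (auto simp: connected_def strongly_connected_def)

text \<open>
  Connectivity and strong connectivity agree only on symmetric subgraphs, and a subgraph of a
  symmetric digraph may keep one arc of an edge and drop the other. Maximality resolves this:
  adding arcs preserves connectivity, so a maximal connected subgraph is induced, hence symmetric.
  Conversely, a connected subgraph above a strongly connected component generates an induced
  subgraph which is strongly connected, so it cannot be larger than the component.
\<close>

lemma (in sym_digraph) components_eq_sccs: "components G = sccs"
proof -
  have induced: "induced_subgraph H G \<Longrightarrow> symmetric H \<and> wf_digraph H" for H
    using induced_graph_imp_symmetric[OF sym_arcs] by blast
  have sc_iff: "connected H \<longleftrightarrow> strongly_connected H" if "induced_subgraph H G" for H
  proof -
    interpret H: wf_digraph H using induced[OF that] by simp
    show ?thesis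
      using induced[OF that] H.symmetric_connected_imp_strongly_connected
        H.strongly_connected_imp_connected by blast
  qed
  have arc_mono: "arc_mono Digraph_Component.connected"
    unfolding arc_mono_def
    by (metis spanning_def subgraphE wf_digraph.connected_spanning_imp_connected)
  show ?thesis
  proof (intro equalityI subsetI)
    fix H assume "H \<in> components G"
    then have max: "max_subgraph Digraph_Component.connected H"
      by (simp add: components_def)
    then have ind: "induced_subgraph H G"
      using arc_mono by (rule induced_subgraphI_arc_mono)
    have conn: "connected H"
      using max by (rule max_subgraph_prop)
    have "\<not> connected K" if "H \<noteq> K" "subgraph H K" "subgraph K G" for K
      using that max by (auto simp: max_subgraph_def)
    moreover have "connected K" if "strongly_connected K" "subgraph K G" for K
      using that wf_digraph.strongly_connected_imp_connected by blast
    ultimately have "max_subgraph strongly_connected H"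
      using conn sc_iff[OF ind] ind induced_imp_subgraph
      by (intro max_subgraphI) blast+
    then show "H \<in> sccs" by (simp add: sccs_altdef2)
  next
    fix H assume H: "H \<in> sccs"
    then have ind: "induced_subgraph H G" and sc: "strongly_connected H"
      by auto
    have max: "max_subgraph strongly_connected H"
      using H by (simp add: sccs_altdef2)
    have "\<not> connected K" if K: "H \<noteq> K" "subgraph H K" "subgraph K G" for K
    proof
      assume conn: "connected K"
      let ?K = "G \<restriction> verts K"
      have KK: "subgraph K ?K" using K(3) by (rule subgraph_induce_subgraphI2)
      have Kind: "induced_subgraph ?K G"
        using K(3) by (intro induced_induce) auto
      have "connected ?K"
        using arc_mono conn KK unfolding arc_mono_def by fastforce
      then have "strongly_connected ?K" using sc_iff[OF Kind] by simp
      moreover have "subgraph H ?K" using K(2) KK by (rule subgraph_trans)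
      ultimately have "?K = H"
        using max Kind induced_imp_subgraph unfolding max_subgraph_def by metis
      with K(2) KK have "K = H" by (auto simp: subgraph_def compatible_def)
      with K(1) show False by simp
    qed
    then have "max_subgraph Digraph_Component.connected H"
      using sc sc_iff[OF ind] ind induced_imp_subgraph
      by (intro max_subgraphI) auto
    then show "H \<in> components G" by (simp add: components_def)
  qed
qed

section \<open>Adjacency and isomorphism for graphs given by relations\<close>

lemma arcs_ends_induce_subgraph:
  "u \<rightarrow>\<^bsub>Y \<restriction> S\<^esub> v \<longleftrightarrow> u \<rightarrow>\<^bsub>Y\<^esub> v \<and> u \<in> S \<and> v \<in> S"
  by (auto simp: arcs_ends_conv)

lemma digraph_iso_with_projI:
  assumes G: "pair_wf_digraph G" and H: "pair_wf_digraph H"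
    and bij: "bij_betw f (pverts G) (pverts H)"
    and adj: "\<And>u v. u \<in> pverts G \<Longrightarrow> v \<in> pverts G \<Longrightarrow>
      (u, v) \<in> parcs G \<longleftrightarrow> (f u, f v) \<in> parcs H"
  shows "digraph_iso G H"
proof -
  interpret G: pair_wf_digraph G by fact
  interpret H: pair_wf_digraph H by fact
  have G_sub: "parcs G \<subseteq> pverts G \<times> pverts G"
    by (auto dest: G.in_arcsD1 G.in_arcsD2)
  let ?h = "\<lparr> iso_verts = f, iso_arcs = map_prod f f, iso_head = snd, iso_tail = fst \<rparr>"
  have inj: "inj_on f (pverts G)" using bij by (rule bij_betw_imp_inj_on)
  have "inj_on (map_prod f f) (parcs G)"
    using map_prod_inj_on[OF inj inj] G_sub by (rule inj_on_subset)
  then have hom: "pre_digraph.digraph_isomorphism (with_proj G) ?h"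
    unfolding pre_digraph.digraph_isomorphism_def
    using inj G by (simp add: wf_digraph_wp_iff)
  have "map_prod f f ` parcs G = parcs H"
  proof (intro equalityI subsetI)
    fix e assume "e \<in> map_prod f f ` parcs G"
    then show "e \<in> parcs H" using adj G_sub by auto
  next
    fix e assume e: "e \<in> parcs H"
    then obtain x y where xy: "e = (x, y)" "x \<in> pverts H" "y \<in> pverts H"
      by (cases e) (auto dest: H.in_arcsD1 H.in_arcsD2)
    then obtain u v where "u \<in> pverts G" "v \<in> pverts G" "x = f u" "y = f v"
      using bij by (metis bij_betw_imp_surj_on imageE)
    then show "e \<in> map_prod f f ` parcs G"
      using e xy adj by (auto intro: rev_image_eqI)
  qed
  then have "with_proj H = app_iso ?h (with_proj G)"
    using bij by (simp add: with_proj_def app_iso_def bij_betw_def)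
  with hom show ?thesis unfolding digraph_iso_def by blast
qed

section \<open>Friends-and-strangers graphs, products and disjoint unions\<close>

lemma pair_wf_digraph_FS: "pair_wf_digraph (FS X Y)"
  by unfold_locales (auto simp: FS_def)

lemma pair_wf_digraph_cartesian_product: "pair_wf_digraph (cartesian_product I G)"
  by unfold_locales (auto simp: cartesian_product_def)

lemma pair_wf_digraph_disjoint_union:
  assumes "\<And>i. i \<in> I \<Longrightarrow> pair_wf_digraph (G i)"
  shows "pair_wf_digraph (disjoint_union I G)"
proof unfold_locales
  fix e assume "e \<in> parcs (disjoint_union I G)"
  then obtain i u v where e: "e = ((i, u), (i, v))" "i \<in> I" "(u, v) \<in> parcs (G i)"
    by (auto simp: disjoint_union_def)
  interpret Gi: pair_wf_digraph "G i" using e(2) by (rule assms)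
  show "fst e \<in> pverts (disjoint_union I G)" "snd e \<in> pverts (disjoint_union I G)"
    using e by (auto simp: disjoint_union_def dest: Gi.in_arcsD1 Gi.in_arcsD2)
qed

lemma FS_adjE:
  assumes "(\<sigma>, \<tau>) \<in> parcs (FS X Y)"
  obtains a b where "a \<rightarrow>\<^bsub>X\<^esub> b" "\<sigma> a \<rightarrow>\<^bsub>Y\<^esub> \<sigma> b" "\<sigma> a = \<tau> b" "\<sigma> b = \<tau> a"
    "\<forall>c\<in>verts X - {a, b}. \<sigma> c = \<tau> c"
  using assms by (auto simp: FS_def)

lemma FS_adjI:
  assumes "\<sigma> \<in> vertex_bijections X Y" "\<tau> \<in> vertex_bijections X Y"
    and "a \<rightarrow>\<^bsub>X\<^esub> b" "\<sigma> a \<rightarrow>\<^bsub>Y\<^esub> \<sigma> b" "\<sigma> a = \<tau> b" "\<sigma> b = \<tau> a"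
    and "\<forall>c\<in>verts X - {a, b}. \<sigma> c = \<tau> c"
  shows "(\<sigma>, \<tau>) \<in> parcs (FS X Y)"
  using assms unfolding FS_def by fastforce

lemma pverts_FS: "pverts (FS X Y) = vertex_bijections X Y"
  by (simp add: FS_def)

text \<open>
  Positions \<open>{1..r}\<close> are replaced by an arbitrary index set, as their order does not matter for the
  decomposition.
\<close>

definition indexed_partitions ::
    "'i set \<Rightarrow> ('i \<Rightarrow> nat) \<Rightarrow> 'a set \<Rightarrow> ('i \<Rightarrow> 'a set) set" where
  "indexed_partitions I m A =
    {V \<in> extensional I. inj_on V I \<and> partition_on A (V ` I) \<and> (\<forall>i\<in>I. card (V i) = m i)}"

lemma ordered_partitions_eq: "ordered_partitions r m A = indexed_partitions {1..r} m A"
  by (simp add: ordered_partitions_def indexed_partitions_def)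

section \<open>Bijections on a graph without edges between its pieces\<close>

text \<open>
  The pieces have to be nonempty because an ordered partition consists of distinct nonempty parts.
  Edges are compared through \<^const>\<open>arcs_ends\<close> since \<^const>\<open>FS\<close> sees only which vertices are
  adjacent, not the arcs that join them.
\<close>

locale graph_splitting =
  fixes X :: "('a, 'b) pre_digraph" and Xs :: "'i \<Rightarrow> ('a, 'b) pre_digraph" and I :: "'i set"
  assumes wf_piece: "i \<in> I \<Longrightarrow> wf_digraph (Xs i)"
    and piece_nonempty: "i \<in> I \<Longrightarrow> verts (Xs i) \<noteq> {}"
    and pieces_disjoint: "disjoint_family_on (\<lambda>i. verts (Xs i)) I"
    and verts_eq: "verts X = (\<Union>i\<in>I. verts (Xs i))"
    and arcs_eq: "arcs_ends X = (\<Union>i\<in>I. arcs_ends (Xs i))"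
begin

definition images :: "('a \<Rightarrow> 'c) \<Rightarrow> 'i \<Rightarrow> 'c set" where
  "images \<sigma> = (\<lambda>i\<in>I. \<sigma> ` verts (Xs i))"

definition restrictions :: "('a \<Rightarrow> 'c) \<Rightarrow> 'i \<Rightarrow> 'a \<Rightarrow> 'c" where
  "restrictions \<sigma> = (\<lambda>i\<in>I. restrict \<sigma> (verts (Xs i)))"

lemma images_simp: "i \<in> I \<Longrightarrow> images \<sigma> i = \<sigma> ` verts (Xs i)"
  by (simp add: images_def)

lemma restrictions_extensional: "restrictions \<sigma> \<in> extensional I"
  by (simp add: restrictions_def)

lemma restrictions_apply:
  "i \<in> I \<Longrightarrow> x \<in> verts (Xs i) \<Longrightarrow> restrictions \<sigma> i x = \<sigma> x"
  by (simp add: restrictions_def)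

lemma piece_unique:
  "i \<in> I \<Longrightarrow> j \<in> I \<Longrightarrow> x \<in> verts (Xs i) \<Longrightarrow> x \<in> verts (Xs j) \<Longrightarrow> i = j"
  using pieces_disjoint unfolding disjoint_family_on_def by blast

lemma piece_verts: "i \<in> I \<Longrightarrow> x \<in> verts (Xs i) \<Longrightarrow> x \<in> verts X"
  using verts_eq by blast

lemma vertex_in_piece:
  assumes "x \<in> verts X"
  obtains i where "i \<in> I" "x \<in> verts (Xs i)"
  using assms verts_eq by blast

lemma images_in_indexed_partitions:
  assumes \<sigma>: "\<sigma> \<in> vertex_bijections X Y"
  shows "images \<sigma> \<in> indexed_partitions I (\<lambda>i. card (verts (Xs i))) (verts Y)"
proof -
  have inj: "inj_on \<sigma> (verts X)" and onto: "\<sigma> ` verts X = verts Y"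
    using \<sigma> by (auto simp: vertex_bijections_def bij_betw_def)
  have disj: "i = j" if "i \<in> I" "j \<in> I" "y \<in> images \<sigma> i" "y \<in> images \<sigma> j" for i j y
    using that piece_unique piece_verts inj_onD[OF inj] by (auto simp: images_simp) metis
  have ne: "images \<sigma> i \<noteq> {}" if "i \<in> I" for i
    using that piece_nonempty by (simp add: images_simp)
  have "inj_on (images \<sigma>) I"
    using disj ne by (intro inj_onI) (metis ex_in_conv)
  moreover have "partition_on (verts Y) (images \<sigma> ` I)"
  proof (rule partition_onI)
    show "\<Union> (images \<sigma> ` I) = verts Y"
      using onto by (simp add: images_simp verts_eq image_UN)
  next
    fix p q assume "p \<in> images \<sigma> ` I" "q \<in> images \<sigma> ` I" "p \<noteq> q"
    then show "disjnt p q" using disj by (auto simp: disjnt_iff)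
  next
    show "{} \<notin> images \<sigma> ` I" using ne by auto
  qed
  moreover have "card (images \<sigma> i) = card (verts (Xs i))" if "i \<in> I" for i
    using that inj piece_verts by (auto simp: images_simp intro!: card_image intro: inj_on_subset)
  ultimately show ?thesis
    by (auto simp: indexed_partitions_def images_def)
qed

lemma restrictions_in_vertex_bijections:
  assumes \<sigma>: "\<sigma> \<in> vertex_bijections X Y" and i: "i \<in> I"
  shows "restrictions \<sigma> i \<in> vertex_bijections (Xs i) (Y \<restriction> images \<sigma> i)"
proof -
  have "inj_on \<sigma> (verts (Xs i))"
    using \<sigma> piece_verts[OF i]
    by (auto simp: vertex_bijections_def bij_betw_def intro: inj_on_subset)
  then show ?thesis
    using i by (simp add: vertex_bijections_def restrictions_def images_def bij_betw_def)
qed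

lemma restrictions_in_PiE:
  "\<sigma> \<in> vertex_bijections X Y \<Longrightarrow>
    restrictions \<sigma> \<in> (\<Pi>\<^sub>E i\<in>I. vertex_bijections (Xs i) (Y \<restriction> images \<sigma> i))"
  by (simp add: PiE_iff restrictions_in_vertex_bijections restrictions_extensional)

text \<open>
  A vertex of \<open>X\<close> lies in exactly one piece, so bijections prescribed on the pieces define a function
  on \<open>X\<close>; it is a bijection because the parts \<open>V i\<close> of its range are disjoint and cover \<open>verts Y\<close>.
\<close>

lemma glue:
  assumes V: "V \<in> indexed_partitions I m (verts Y)"
    and u: "u \<in> (\<Pi>\<^sub>E i\<in>I. vertex_bijections (Xs i) (Y \<restriction> V i))"
  obtains \<sigma> where "\<sigma> \<in> vertex_bijections X Y" "images \<sigma> = V" "restrictions \<sigma> = u"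
proof -
  have V_ext: "V \<in> extensional I" and V_inj: "inj_on V I"
    and V_part: "partition_on (verts Y) (V ` I)"
    using V by (auto simp: indexed_partitions_def)
  have u_ext: "u i \<in> extensional (verts (Xs i))"
    and u_bij: "bij_betw (u i) (verts (Xs i)) (V i)" if "i \<in> I" for i
    using u that by (auto simp: vertex_bijections_def PiE_iff)
  define \<sigma> where "\<sigma> = (\<lambda>x\<in>verts X. u (THE i. i \<in> I \<and> x \<in> verts (Xs i)) x)"
  have \<sigma>_eq: "\<sigma> x = u i x" if "i \<in> I" "x \<in> verts (Xs i)" for i x
  proof -
    have "(THE i. i \<in> I \<and> x \<in> verts (Xs i)) = i"
      using that piece_unique by (intro the_equality) auto
    then show ?thesis using that piece_verts by (simp add: \<sigma>_def)
  qed
  have bij_i: "bij_betw \<sigma> (verts (Xs i)) (V i)" if "i \<in> I" for i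
    using u_bij[OF that] \<sigma>_eq[OF that] by (simp cong: bij_betw_cong)
  have "disjoint_family_on V I"
    using V_part V_inj
    by (metis disjoint_image_disjoint_family_on partition_onD2)
  then have "bij_betw \<sigma> (\<Union>i\<in>I. verts (Xs i)) (\<Union>i\<in>I. V i)"
    using bij_i by (rule bij_betw_UNION_disjoint)
  then have "bij_betw \<sigma> (verts X) (verts Y)"
    using partition_onD1[OF V_part] verts_eq by simp
  then have 1: "\<sigma> \<in> vertex_bijections X Y"
    by (simp add: vertex_bijections_def \<sigma>_def)
  have 2: "images \<sigma> = V"
    using V_ext bij_i
    by (intro extensionalityI[of _ "I"]) (auto simp: images_def bij_betw_def)
  have 3: "restrictions \<sigma> = u"
  proof (rule extensionalityI[of _ "I"])
    fix i assume i: "i \<in> I"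
    then have "restrict \<sigma> (verts (Xs i)) = u i"
      using u_ext \<sigma>_eq by (intro extensionalityI[of _ "verts (Xs i)"]) auto
    then show "restrictions \<sigma> i = u i" using i by (simp add: restrictions_def)
  qed (use u in \<open>auto simp: restrictions_extensional PiE_iff\<close>)
  show thesis using that[OF 1 2 3] .
qed

lemma bij_betw_split:
  fixes Y :: "('c, 'd) pre_digraph"
  shows "bij_betw (\<lambda>\<sigma>. (images \<sigma>, restrictions \<sigma>)) (vertex_bijections X Y)
    (SIGMA V:indexed_partitions I (\<lambda>i. card (verts (Xs i))) (verts Y).
      \<Pi>\<^sub>E i\<in>I. vertex_bijections (Xs i) (Y \<restriction> V i))"
proof (rule bij_betw_imageI)
  show "inj_on (\<lambda>\<sigma>. (images \<sigma>, restrictions \<sigma>)) (vertex_bijections X Y)"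
  proof (rule inj_onI)
    fix \<sigma> \<tau> :: "'a \<Rightarrow> 'c"
    assume ext: "\<sigma> \<in> vertex_bijections X Y" "\<tau> \<in> vertex_bijections X Y"
      and eq: "(images \<sigma>, restrictions \<sigma>) = (images \<tau>, restrictions \<tau>)"
    show "\<sigma> = \<tau>"
    proof (rule extensionalityI[of _ "verts X"])
      fix x assume "x \<in> verts X"
      then obtain i where "i \<in> I" "x \<in> verts (Xs i)" by (rule vertex_in_piece)
      then show "\<sigma> x = \<tau> x" using eq restrictions_apply by (metis prod.inject)
    qed (use ext in \<open>auto simp: vertex_bijections_def\<close>)
  qed
  show "(\<lambda>\<sigma>. (images \<sigma>, restrictions \<sigma>)) ` vertex_bijections X Y =
    (SIGMA V:indexed_partitions I (\<lambda>i. card (verts (Xs i))) (verts Y).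
      \<Pi>\<^sub>E i\<in>I. vertex_bijections (Xs i) (Y \<restriction> V i))" (is "?f ` _ = ?S")
  proof (intro equalityI subsetI)
    fix p assume "p \<in> ?f ` vertex_bijections X Y"
    then show "p \<in> ?S"
      using images_in_indexed_partitions restrictions_in_PiE by fastforce
  next
    fix p assume "p \<in> ?S"
    then obtain V u where p: "p = (V, u)"
      and V: "V \<in> indexed_partitions I (\<lambda>i. card (verts (Xs i))) (verts Y)"
      and u: "u \<in> (\<Pi>\<^sub>E i\<in>I. vertex_bijections (Xs i) (Y \<restriction> V i))" by blast
    from V u obtain \<sigma> where "\<sigma> \<in> vertex_bijections X Y" "images \<sigma> = V" "restrictions \<sigma> = u"
      by (rule glue)
    then show "p \<in> ?f ` vertex_bijections X Y" using p by blast
  qed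
qed

text \<open>
  The two ends of the edge of a swap lie in one piece. This piece keeps its set of labels, since
  its bijection changes only by a transposition of two of them, and all other pieces are untouched.
  Conversely, a swap of the restrictions to one piece extends by the unchanged values on the rest.
\<close>

lemma FS_adj_iff:
  assumes \<sigma>: "\<sigma> \<in> vertex_bijections X Y" and \<tau>: "\<tau> \<in> vertex_bijections X Y"
  shows "(\<sigma>, \<tau>) \<in> parcs (FS X Y) \<longleftrightarrow>
    images \<sigma> = images \<tau> \<and>
    (\<exists>i\<in>I. (restrictions \<sigma> i, restrictions \<tau> i) \<in> parcs (FS (Xs i) (Y \<restriction> images \<sigma> i)) \<and>
      (\<forall>j\<in>I - {i}. restrictions \<sigma> j = restrictions \<tau> j))"
    (is "?L \<longleftrightarrow> ?R")
proof
  assume ?L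
  then obtain a b where ab: "a \<rightarrow>\<^bsub>X\<^esub> b" "\<sigma> a \<rightarrow>\<^bsub>Y\<^esub> \<sigma> b" "\<sigma> a = \<tau> b" "\<sigma> b = \<tau> a"
    and off: "\<forall>c\<in>verts X - {a, b}. \<sigma> c = \<tau> c"
    by (rule FS_adjE)
  obtain i where i: "i \<in> I" and ab_i: "a \<rightarrow>\<^bsub>Xs i\<^esub> b"
    using ab(1) arcs_eq by auto
  interpret Xi: wf_digraph "Xs i" using i by (rule wf_piece)
  have ab_verts: "a \<in> verts (Xs i)" "b \<in> verts (Xs i)"
    using ab_i by (auto dest: Xi.adj_in_verts)
  have other: "\<sigma> c = \<tau> c" if "j \<in> I" "j \<noteq> i" "c \<in> verts (Xs j)" for j c
    using that off piece_verts piece_unique i ab_verts by blast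
  \<comment> \<open>the transposed pair of labels is the same set, and off the pair nothing moves\<close>
  have "\<sigma> ` verts (Xs i) = \<tau> ` verts (Xs i)"
  proof -
    have "\<sigma> ` (verts (Xs i) - {a, b}) = \<tau> ` (verts (Xs i) - {a, b})"
      using off piece_verts[OF i] by (intro image_cong) auto
    moreover have "verts (Xs i) = (verts (Xs i) - {a, b}) \<union> {a, b}"
      using ab_verts by blast
    moreover have "\<sigma> ` {a, b} = \<tau> ` {a, b}" using ab by auto
    ultimately show ?thesis by (metis image_Un)
  qed
  then have im: "images \<sigma> = images \<tau>"
    unfolding images_def using other by (intro restrict_ext) (metis image_cong)
  have "(restrictions \<sigma> i, restrictions \<tau> i) \<in> parcs (FS (Xs i) (Y \<restriction> images \<sigma> i))"
  proof (rule FS_adjI)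
    show "restrictions \<sigma> i \<in> vertex_bijections (Xs i) (Y \<restriction> images \<sigma> i)"
      "restrictions \<tau> i \<in> vertex_bijections (Xs i) (Y \<restriction> images \<sigma> i)"
      using restrictions_in_vertex_bijections[OF \<sigma> i] restrictions_in_vertex_bijections[OF \<tau> i] im
      by auto
    show "a \<rightarrow>\<^bsub>Xs i\<^esub> b" by fact
    show "restrictions \<sigma> i a \<rightarrow>\<^bsub>Y \<restriction> images \<sigma> i\<^esub> restrictions \<sigma> i b"
      using ab(2) ab_verts i by (simp add: restrictions_apply arcs_ends_induce_subgraph images_simp)
  qed (use ab ab_verts i off piece_verts in \<open>auto simp: restrictions_apply\<close>)
  moreover have "restrictions \<sigma> j = restrictions \<tau> j" if "j \<in> I - {i}" for j
    using that other by (auto simp: restrictions_def)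
  ultimately show ?R using im i by blast
next
  assume ?R
  then obtain i where i: "i \<in> I"
    and adj: "(restrictions \<sigma> i, restrictions \<tau> i) \<in> parcs (FS (Xs i) (Y \<restriction> images \<sigma> i))"
    and other: "\<And>j. j \<in> I \<Longrightarrow> j \<noteq> i \<Longrightarrow> restrictions \<sigma> j = restrictions \<tau> j"
    by auto
  from adj obtain a b where ab_i: "a \<rightarrow>\<^bsub>Xs i\<^esub> b"
    and Y: "restrictions \<sigma> i a \<rightarrow>\<^bsub>Y \<restriction> images \<sigma> i\<^esub> restrictions \<sigma> i b"
    and swap: "restrictions \<sigma> i a = restrictions \<tau> i b" "restrictions \<sigma> i b = restrictions \<tau> i a"
    and off: "\<forall>c\<in>verts (Xs i) - {a, b}. restrictions \<sigma> i c = restrictions \<tau> i c"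
    by (rule FS_adjE)
  interpret Xi: wf_digraph "Xs i" using i by (rule wf_piece)
  have ab_verts: "a \<in> verts (Xs i)" "b \<in> verts (Xs i)"
    using ab_i by (auto dest: Xi.adj_in_verts)
  show ?L
  proof (rule FS_adjI[OF \<sigma> \<tau>])
    show "a \<rightarrow>\<^bsub>X\<^esub> b" using ab_i i arcs_eq by blast
    show "\<sigma> a \<rightarrow>\<^bsub>Y\<^esub> \<sigma> b" "\<sigma> a = \<tau> b" "\<sigma> b = \<tau> a"
      using Y swap i ab_verts by (auto simp: restrictions_apply arcs_ends_induce_subgraph)
  next
    show "\<forall>c\<in>verts X - {a, b}. \<sigma> c = \<tau> c"
    proof
      fix c assume c: "c \<in> verts X - {a, b}"
      then obtain j where j: "j \<in> I" "c \<in> verts (Xs j)" by (metis DiffD1 vertex_in_piece)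
      then have "restrictions \<sigma> j c = restrictions \<tau> j c"
        using other off c by (cases "j = i") auto
      then show "\<sigma> c = \<tau> c" using j by (simp add: restrictions_apply)
    qed
  qed
qed

lemma FS_iso_disjoint_union:
  "digraph_iso (FS X Y)
    (disjoint_union (indexed_partitions I (\<lambda>i. card (verts (Xs i))) (verts Y))
      (\<lambda>V. cartesian_product I (\<lambda>i. FS (Xs i) (Y \<restriction> V i))))"
proof (rule digraph_iso_with_projI)
  let ?f = "\<lambda>\<sigma>. (images \<sigma>, restrictions \<sigma>)"
  let ?H = "disjoint_union (indexed_partitions I (\<lambda>i. card (verts (Xs i))) (verts Y))
      (\<lambda>V. cartesian_product I (\<lambda>i. FS (Xs i) (Y \<restriction> V i)))"
  show "pair_wf_digraph (FS X Y)" by (rule pair_wf_digraph_FS)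
  show "pair_wf_digraph ?H"
    by (intro pair_wf_digraph_disjoint_union pair_wf_digraph_cartesian_product)
  show bij: "bij_betw ?f (pverts (FS X Y)) (pverts ?H)"
    using bij_betw_split[of Y] by (simp add: disjoint_union_def cartesian_product_def pverts_FS)
  fix \<sigma> \<tau> assume "\<sigma> \<in> pverts (FS X Y)" "\<tau> \<in> pverts (FS X Y)"
  moreover from this have "?f \<sigma> \<in> pverts ?H" "?f \<tau> \<in> pverts ?H"
    using bij by (auto simp: bij_betw_def)
  ultimately show "(\<sigma>, \<tau>) \<in> parcs (FS X Y) \<longleftrightarrow> (?f \<sigma>, ?f \<tau>) \<in> parcs ?H"
    by (auto simp: pverts_FS FS_adj_iff disjoint_union_def cartesian_product_def)
qed

end

section \<open>The decomposition along connected components\<close>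

lemma (in sym_digraph) graph_splitting_components:
  assumes Xs: "bij_betw Xs {1..r} (components G)"
  shows "graph_splitting G Xs {1..r}"
proof -
  have range: "Xs ` {1..r} = sccs"
    using Xs by (simp add: bij_betw_def components_eq_sccs)
  have compat: "tail H = tail G" "head H = head G" if "H \<in> sccs" for H
    using in_sccs_imp_induced[OF that] induced_imp_subgraph
    by (fastforce simp: subgraph_def compatible_def)+
  have union: "verts G = (\<Union>H\<in>sccs. verts H)" "arcs G = (\<Union>H\<in>sccs. arcs H)"
    by (metis Union_def graph_is_union_sccs pre_digraph.select_convs(1))
      (metis Union_def graph_is_union_sccs pre_digraph.select_convs(2))
  have in_sccs: "Xs i \<in> sccs" if "i \<in> {1..r}" for i
    using that range by blast
  show ?thesis
  proof (rule graph_splitting.intro)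
    fix i assume "i \<in> {1..r}"
    then have "induced_subgraph (Xs i) G" "strongly_connected (Xs i)"
      using in_sccs by auto
    then show "wf_digraph (Xs i)" "verts (Xs i) \<noteq> {}"
      by (auto simp: strongly_connected_def)
  next
    show "disjoint_family_on (\<lambda>i. verts (Xs i)) {1..r}"
      unfolding disjoint_family_on_def
      using Xs in_sccs scc_disj by (metis bij_betw_imp_inj_on inj_onD)
  next
    show "verts G = (\<Union>i\<in>{1..r}. verts (Xs i))"
      using union(1) range by (metis image_image)
  next
    have "arcs_ends G = (\<Union>H\<in>sccs. arcs_ends H)"
      using compat by (auto simp: arcs_ends_conv union(2))
    then show "arcs_ends G = (\<Union>i\<in>{1..r}. arcs_ends (Xs i))"
      using range by (metis image_image)
  qed
qed

theorem proposition2p4: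
  fixes X :: "('a, 'b) pre_digraph" and Y :: "('c, 'd) pre_digraph"
    and n r :: nat
    and Xs :: "nat \<Rightarrow> ('a, 'b) pre_digraph"
    and ns :: "nat \<Rightarrow> nat"
  assumes "graph X" and "graph Y"
    and "card (verts X) = n" and "card (verts Y) = n"
    and "bij_betw Xs {1..r} (components X)"
    and "\<And>i. i \<in> {1..r} \<Longrightarrow> ns i = card (verts (Xs i))"
  shows "digraph_iso (FS X Y)
    (disjoint_union (ordered_partitions r ns (verts Y))
      (\<lambda>V. cartesian_product {1..r} (\<lambda>i. FS (Xs i) (Y \<restriction> V i))))"
proof -
  interpret X: graph X by fact
  interpret graph_splitting X Xs "{1..r}"
    using assms(5) by (rule X.graph_splitting_components)
  have "ordered_partitions r ns (verts Y) =
      indexed_partitions {1..r} (\<lambda>i. card (verts (Xs i))) (verts Y)"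
    using assms(6) by (auto simp: ordered_partitions_eq indexed_partitions_def)
  then show ?thesis using FS_iso_disjoint_union[of Y] by simp
qed

end
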